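(* Let $x=(\mathbb{M},\Gamma,\mathcal{P},\mathsf{T})$ be a tiling, and let $\Omega(x)$ be its hull. (i) If the tiling $x$ is repetitive, then the dynamical system $(\Omega(x),\Gamma)$ is minimal. (ii) If the dynamical system $(\Omega(x),\Gamma)$ is minimal, and $\Omega(x)$ is a compact set, then the tiling $x$ is repetitive.
   Context: $\mathbb{M}$ is the Euclidean plane $\mathbb{E}^2$ or the hyperbolic plane $\mathbb{H}^2$, with a base point $O$ (the origin), and $\Gamma$ is a subgroup of the isometry group $\mathrm{Isom}(\mathbb{M})$. A tile is a compact subset of $\mathbb{M}$ which is the closure of its interior; a labelled tile is a pair (tile, element of a finite set of labels). Two labelled tiles are equivalent if they have the same label and one is the image of the other under an element of $\Gamma$; an equivalence class is called a prototile. A tiling $(\mathbb{M},\Gamma,\mathcal{P},\mathsf{T})$ modelled on a finite set $\mathcal{P}$ of prototiles is a set $\mathsf{T}$ of (labelled) tiles, each belonging to an element of $\mathcal{P}$, whose union is $\mathbb{M}$ and such that distinct tiles of $\mathsf{T}$ have disjoint interiors. A patch of a tiling is a connected finite union of its tiles; its support is the union of its tiles as a subset of $\mathbb{M}$. $\Sigma_{\mathcal{P}}$ is the set of all tilings of $\mathbb{M}$ modelled on $\mathcal{P}$; $\Gamma$ acts on it by $g(\mathbb{M},\Gamma,\mathcal{P},\mathsf{T})=(\mathbb{M},\Gamma,\mathcal{P},g\mathsf{T})$ with $g\mathsf{T}=\{gT: T\in\mathsf{T}\}$. Let $B_r$ be the closed ball of radius $r$ centered at $O$, $\|g\|_r=\sup_{Q\in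 B_r}d(Q,gQ)$, and let $B_{1/r}[x]$ be the set of patches of $x$ whose support contains $B_{1/r}$. $\Sigma_{\mathcal{P}}$ has the topology of the distance $d(x,y)=\inf(\{1\}\cup A(x,y))$, where $A(x,y)=\{r>0 : \exists p\in B_{1/r}[x],\ \exists q\in B_{1/r}[y],\ \exists g\in\Gamma,\ gp=q,\ \|g\|_{1/r}\le r\}$. The hull is $\Omega(x)=\overline{\Gamma x}$ (closure in $\Sigma_{\mathcal{P}}$). $(\Omega(x),\Gamma)$ is minimal if every $\Gamma$-orbit is dense in $\Omega(x)$. The tiling $x$ is repetitive if for any patch $P$ of $x$ there exists $r>0$ such that in any ball of $\mathbb{M}$ of radius $r$ there is a copy $gP$ of $P$ for some $g\in\Gamma$ (i.e. the tiles of $gP$ are tiles of $x$ and are contained in the ball).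
   Formalization: Part (i) additionally assumes d(x,x)=0, i.e. x has patches covering arbitrarily large balls about O; this is automatic for connected tiles and part of d being a distance, but can fail for disconnected tiles, where (i) is false. *)

theory Defs
  imports "HOL-Analysis.Analysis" "HOL-Algebra.Bij"
begin

section \<open>The two planes\<close>

definition euclidean_plane :: "complex metric"
  where "euclidean_plane = euclidean_metric"

text \<open>The Poincare disc model of curvature \<open>-1\<close>.\<close>

definition poincare_dist :: "complex \<Rightarrow> complex \<Rightarrow> real"
  where "poincare_dist z w =
    arcosh (1 + 2 * (cmod (z - w))\<^sup>2 / ((1 - (cmod z)\<^sup>2) * (1 - (cmod w)\<^sup>2)))"

text \<open>\<^locale>\<open>Metric_space\<close> asks for nonnegativity and symmetry outside the carrier as well,
  hence the value 0 there.\<close>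

definition hyperbolic_plane :: "complex metric"
  where "hyperbolic_plane = metric (ball 0 1,
    \<lambda>z w. if z \<in> ball 0 1 \<and> w \<in> ball 0 1 then poincare_dist z w else 0)"

text \<open>The triangle inequality, by way of the hyperboloid model: \<open>A\<close>, \<open>B\<close>, \<open>C\<close> are the negatives of
  the Minkowski products of three points, whose Gram determinant is nonpositive.\<close>

lemma arcosh_triangle:
  fixes A B C :: real
  assumes "A \<ge> 1" "B \<ge> 1" "C \<ge> 1" and gram: "A\<^sup>2 + B\<^sup>2 + C\<^sup>2 \<le> 1 + 2 * A * B * C"
  shows "arcosh C \<le> arcosh A + arcosh B"
proof -
  define a b where "a = arcosh A" and "b = arcosh B"
  have a: "a \<ge> 0" "cosh a = A" and b: "b \<ge> 0" "cosh b = B"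
    using assms by (auto simp: a_def b_def arcosh_nonneg_real cosh_arcosh_real)
  have "(C - A * B)\<^sup>2 \<le> (A\<^sup>2 - 1) * (B\<^sup>2 - 1)"
    using gram by (simp add: power2_eq_square algebra_simps)
  also have "\<dots> = (sinh a * sinh b)\<^sup>2"
    by (simp add: power_mult_distrib sinh_square_eq a b)
  finally have "C - A * B \<le> sinh a * sinh b"
    using a(1) b(1) by (auto dest: power2_le_imp_le)
  then have "cosh (arcosh C) \<le> cosh (a + b)"
    using assms by (simp add: cosh_add a b cosh_arcosh_real)
  moreover have "cosh (arcosh C) \<le> cosh (a + b) \<longleftrightarrow> arcosh C \<le> a + b"
    using a(1) b(1) \<open>C \<ge> 1\<close> by (simp only: cosh_real_nonneg_le_iff arcosh_nonneg_real add_nonneg_nonneg)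
  ultimately show ?thesis
    by (simp only: a_def b_def)
qed

lemma gram_hyperboloid:
  fixes x0 :: real
  assumes "x0\<^sup>2 = 1 + x1\<^sup>2 + x2\<^sup>2" "y0\<^sup>2 = 1 + y1\<^sup>2 + y2\<^sup>2" "z0\<^sup>2 = 1 + z1\<^sup>2 + z2\<^sup>2"
    and A: "A = x0*y0 - x1*y1 - x2*y2" and B: "B = y0*z0 - y1*z1 - y2*z2"
    and C: "C = x0*z0 - x1*z1 - x2*z2"
  shows "A\<^sup>2 + B\<^sup>2 + C\<^sup>2 \<le> 1 + 2 * A * B * C"
proof -
  define K where "K = 1 - B\<^sup>2"
  define p q r where "p = y1*z2 - y2*z1" and "q = y0*z2 - y2*z0" and "r = y0*z1 - y1*z0"
  have Y: "y0\<^sup>2 - y1\<^sup>2 - y2\<^sup>2 = 1" and Z: "z0\<^sup>2 - z1\<^sup>2 - z2\<^sup>2 = 1"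
    using assms(2,3) by simp_all
  have K: "K = (y0\<^sup>2 - y1\<^sup>2 - y2\<^sup>2) * (z0\<^sup>2 - z1\<^sup>2 - z2\<^sup>2) - B\<^sup>2"
    by (simp add: K_def Y Z)
  have coeffs:
    "K + 2*B*(y0*z0) - (y0\<^sup>2 - y1\<^sup>2 - y2\<^sup>2) * z0\<^sup>2 - (z0\<^sup>2 - z1\<^sup>2 - z2\<^sup>2) * y0\<^sup>2 = p\<^sup>2"
    "- K + 2*B*(y1*z1) - (y0\<^sup>2 - y1\<^sup>2 - y2\<^sup>2) * z1\<^sup>2 - (z0\<^sup>2 - z1\<^sup>2 - z2\<^sup>2) * y1\<^sup>2 = q\<^sup>2"
    "- K + 2*B*(y2*z2) - (y0\<^sup>2 - y1\<^sup>2 - y2\<^sup>2) * z2\<^sup>2 - (z0\<^sup>2 - z1\<^sup>2 - z2\<^sup>2) * y2\<^sup>2 = r\<^sup>2"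
    "(y0\<^sup>2 - y1\<^sup>2 - y2\<^sup>2)*(z0*z1) + (z0\<^sup>2 - z1\<^sup>2 - z2\<^sup>2)*(y0*y1) - B*(y0*z1 + y1*z0) = - (p*q)"
    "(y0\<^sup>2 - y1\<^sup>2 - y2\<^sup>2)*(z0*z2) + (z0\<^sup>2 - z1\<^sup>2 - z2\<^sup>2)*(y0*y2) - B*(y0*z2 + y2*z0) = p*r"
    "- (y0\<^sup>2 - y1\<^sup>2 - y2\<^sup>2)*(z1*z2) - (z0\<^sup>2 - z1\<^sup>2 - z2\<^sup>2)*(y1*y2) + B*(y1*z2 + y2*z1) = - (q*r)"
    unfolding K unfolding B p_def q_def r_def by algebra+
  have "(x0*p - x1*q + x2*r)\<^sup>2 = x0\<^sup>2 * p\<^sup>2 + x1\<^sup>2 * q\<^sup>2 + x2\<^sup>2 * r\<^sup>2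
      + 2*x0*x1*(- (p*q)) + 2*x0*x2*(p*r) + 2*x1*x2*(- (q*r))"
    by algebra
  also have "\<dots> = (x0\<^sup>2 - x1\<^sup>2 - x2\<^sup>2) * K + 2*A*B*C - C\<^sup>2 - A\<^sup>2"
    unfolding coeffs[symmetric, unfolded Y Z] A C by algebra
  also have "\<dots> = 1 + 2*A*B*C - A\<^sup>2 - B\<^sup>2 - C\<^sup>2"
    using assms(1) by (simp add: K_def)
  finally show ?thesis
    using zero_le_power2[of "x0*p - x1*q + x2*r"] by linarith
qed

lemma hyperboloid_point:
  fixes z :: complex
  assumes "cmod z < 1"
  defines "p \<equiv> 1 - (cmod z)\<^sup>2"
  shows "((1 + (cmod z)\<^sup>2) / p)\<^sup>2 = 1 + (2 * Re z / p)\<^sup>2 + (2 * Im z / p)\<^sup>2"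
proof -
  have "(cmod z)\<^sup>2 < 1" using assms(1) by (simp add: abs_square_less_1)
  then have "p \<noteq> 0" by (simp add: p_def)
  moreover have "(1 + (cmod z)\<^sup>2)\<^sup>2 = p\<^sup>2 + (2 * Re z)\<^sup>2 + (2 * Im z)\<^sup>2"
    unfolding p_def cmod_power2 by algebra
  ultimately show ?thesis
    by (simp add: power_divide add_divide_distrib[symmetric] divide_eq_eq eq_divide_eq algebra_simps)
qed

lemma hyperboloid_product:
  fixes z w :: complex
  assumes "cmod z < 1" "cmod w < 1"
  defines "p \<equiv> 1 - (cmod z)\<^sup>2" and "q \<equiv> 1 - (cmod w)\<^sup>2"
  shows "1 + 2 * (cmod (z - w))\<^sup>2 / (p * q) =
    ((1 + (cmod z)\<^sup>2) / p) * ((1 + (cmod w)\<^sup>2) / q)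
      - (2 * Re z / p) * (2 * Re w / q) - (2 * Im z / p) * (2 * Im w / q)"
proof -
  have "(cmod z)\<^sup>2 < 1" "(cmod w)\<^sup>2 < 1"
    using assms(1,2) by (simp_all add: abs_square_less_1)
  then have "p \<noteq> 0" "q \<noteq> 0" by (simp_all add: p_def q_def)
  moreover have "p * q + 2 * (cmod (z - w))\<^sup>2 =
      (1 + (cmod z)\<^sup>2) * (1 + (cmod w)\<^sup>2) - (2 * Re z) * (2 * Re w) - (2 * Im z) * (2 * Im w)"
    unfolding p_def q_def cmod_power2 minus_complex.sel by algebra
  moreover have "1 + 2 * (cmod (z - w))\<^sup>2 / (p * q) = (p * q + 2 * (cmod (z - w))\<^sup>2) / (p * q)"
    using \<open>p \<noteq> 0\<close> \<open>q \<noteq> 0\<close> by (simp add: add_divide_distrib)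
  ultimately show ?thesis
    by (simp only: diff_divide_distrib times_divide_times_eq)
qed

lemma Metric_space_poincare:
  "Metric_space (ball 0 1) (\<lambda>z w. if z \<in> ball 0 1 \<and> w \<in> ball 0 1 then poincare_dist z w else 0)"
proof -
  define E where "E = (\<lambda>z w. 1 + 2 * (cmod (z - w))\<^sup>2 / ((1 - (cmod z)\<^sup>2) * (1 - (cmod w)\<^sup>2)))"
  have pos: "1 - (cmod z)\<^sup>2 > 0" if "cmod z < 1" for z
    using that by (simp add: power_less_one_iff abs_square_less_1)
  have ge1: "E z w \<ge> 1" if "cmod z < 1" "cmod w < 1" for z w
    using pos[OF that(1)] pos[OF that(2)] by (simp add: E_def)
  have dist: "poincare_dist z w = arcosh (E z w)" for z w
    by (simp add: poincare_dist_def E_def)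
  have nonneg: "poincare_dist z w \<ge> 0" if "cmod z < 1" "cmod w < 1" for z w
    using ge1[OF that] by (simp add: dist arcosh_nonneg_real)
  have zero: "poincare_dist z w = 0 \<longleftrightarrow> z = w" if "cmod z < 1" "cmod w < 1" for z w
  proof
    assume "poincare_dist z w = 0"
    then have "E z w = 1"
      using ge1[OF that] cosh_arcosh_real[of "E z w"] by (simp add: dist)
    then show "z = w"
      using pos[OF that(1)] pos[OF that(2)] by (auto simp: E_def)
  qed (simp add: poincare_dist_def)
  have commute: "poincare_dist z w = poincare_dist w z" for z w
    by (simp add: poincare_dist_def norm_minus_commute mult.commute)
  have triangle: "poincare_dist x z \<le> poincare_dist x y + poincare_dist y z"
    if "cmod x < 1" "cmod y < 1" "cmod z < 1" for x y z
    unfolding dist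
    by (intro arcosh_triangle ge1 that gram_hyperboloid[OF
          hyperboloid_point[OF that(1)] hyperboloid_point[OF that(2)] hyperboloid_point[OF that(3)]])
       (simp_all add: E_def hyperboloid_product that)
  show ?thesis
    by unfold_locales (auto simp: nonneg zero commute triangle)
qed

lemma mspace_hyperbolic_plane [simp]: "mspace hyperbolic_plane = ball 0 1"
  by (simp only: hyperbolic_plane_def Metric_space.mspace_metric[OF Metric_space_poincare])

lemma mdist_hyperbolic_plane:
  "z \<in> ball 0 1 \<Longrightarrow> w \<in> ball 0 1 \<Longrightarrow> mdist hyperbolic_plane z w = poincare_dist z w"
  by (simp only: hyperbolic_plane_def Metric_space.mdist_metric[OF Metric_space_poincare] if_True simp_thms)


section \<open>Isometries\<close>

definition isometries :: "'a metric \<Rightarrow> ('a \<Rightarrow> 'a) set"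
  where "isometries m =
    {g \<in> Bij (mspace m). \<forall>u\<in>mspace m. \<forall>v\<in>mspace m. mdist m (g u) (g v) = mdist m u v}"

definition isom_group :: "'a metric \<Rightarrow> ('a \<Rightarrow> 'a) monoid"
  where "isom_group m = (BijGroup (mspace m)) \<lparr>carrier := isometries m\<rparr>"

lemma subgroup_isometries: "subgroup (isometries m) (BijGroup (mspace m))"
proof -
  interpret group "BijGroup (mspace m)" by (rule group_BijGroup)
  have mem: "g u \<in> mspace m" if "g \<in> Bij (mspace m)" "u \<in> mspace m" for g u
    using Bij_imp_funcset[OF that(1)] that(2) by blast
  show ?thesis
  proof
    show "isometries m \<subseteq> carrier (BijGroup (mspace m))"
      by (auto simp: isometries_def BijGroup_def)
    show "\<one>\<^bsub>BijGroup (mspace m)\<^esub> \<in> isometries m"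
      by (auto simp: isometries_def BijGroup_def id_Bij)
  next
    fix g h assume "g \<in> isometries m" "h \<in> isometries m"
    then show "g \<otimes>\<^bsub>BijGroup (mspace m)\<^esub> h \<in> isometries m"
      by (auto simp: isometries_def BijGroup_def compose_Bij compose_eq mem)
  next
    fix g assume g: "g \<in> isometries m"
    then have bij: "g \<in> Bij (mspace m)" "bij_betw g (mspace m) (mspace m)"
      by (auto simp: isometries_def Bij_def)
    have iso: "mdist m (g u) (g v) = mdist m u v" if "u \<in> mspace m" "v \<in> mspace m" for u v
      using g that by (auto simp: isometries_def)
    have "mdist m (inv_into (mspace m) g u) (inv_into (mspace m) g v) = mdist m u v"
      if "u \<in> mspace m" "v \<in> mspace m" for u v
      using iso[OF Bij_inv_into_mem[OF bij(1) that(1)] Bij_inv_into_mem[OF bij(1) that(2)]]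
      by (simp add: bij_betw_inv_into_right[OF bij(2)] that)
    then show "inv\<^bsub>BijGroup (mspace m)\<^esub> g \<in> isometries m"
      using bij by (auto simp: isometries_def inv_BijGroup restrict_inv_into_Bij)
  qed
qed

lemma group_isom_group: "group (isom_group m)"
  unfolding isom_group_def
  by (rule group.subgroup_imp_group[OF group_BijGroup subgroup_isometries])


section \<open>Tiles, prototiles, tilings and patches\<close>

definition tile :: "'a metric \<Rightarrow> 'a set \<Rightarrow> bool"
  where "tile m S \<longleftrightarrow> compactin (mtopology_of m) S \<and>
    S = mtopology_of m closure_of (mtopology_of m interior_of S)"

definition labelled_tiles :: "'a metric \<Rightarrow> ('a set \<times> 'l) set"
  where "labelled_tiles m = {S. tile m S} \<times> UNIV"

definition tile_equiv :: "'a metric \<Rightarrow> ('a \<Rightarrow> 'a) set \<Rightarrow> (('a set \<times> 'l) \<times> ('a set \<times> 'l)) set"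
  where "tile_equiv m \<Gamma> = {((S, a), (S', a')).
    (S, a) \<in> labelled_tiles m \<and> (S', a') \<in> labelled_tiles m \<and> a = a' \<and> (\<exists>g\<in>\<Gamma>. S' = g ` S)}"

definition prototiles :: "'a metric \<Rightarrow> ('a \<Rightarrow> 'a) set \<Rightarrow> ('a set \<times> 'l) set set"
  where "prototiles m \<Gamma> = labelled_tiles m // tile_equiv m \<Gamma>"

definition support :: "('a set \<times> 'l) set \<Rightarrow> 'a set"
  where "support p = (\<Union>(S, a)\<in>p. S)"

text \<open>For fixed \<open>m\<close>, \<open>\<Gamma>\<close> and \<open>\<P>\<close>, a tiling is given by its set of labelled tiles.\<close>

definition tilings :: "'a metric \<Rightarrow> ('a set \<times> 'l) set set \<Rightarrow> ('a set \<times> 'l) set set"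
  where "tilings m \<P> = {x. x \<subseteq> \<Union>\<P> \<and> support x = mspace m \<and>
    (\<forall>s\<in>x. \<forall>t\<in>x. s \<noteq> t \<longrightarrow>
      disjnt (mtopology_of m interior_of fst s) (mtopology_of m interior_of fst t))}"

definition patches :: "'a metric \<Rightarrow> ('a set \<times> 'l) set \<Rightarrow> ('a set \<times> 'l) set set"
  where "patches m x = {p. p \<subseteq> x \<and> finite p \<and> connectedin (mtopology_of m) (support p)}"

definition act :: "('a \<Rightarrow> 'a) \<Rightarrow> ('a set \<times> 'l) set \<Rightarrow> ('a set \<times> 'l) set"
  where "act g x = (\<lambda>(S, a). (g ` S, a)) ` x"


section \<open>The space of tilings\<close>

definition displacement :: "'a metric \<Rightarrow> 'a \<Rightarrow> real \<Rightarrow> ('a \<Rightarrow> 'a) \<Rightarrow> real"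
  where "displacement m b r g = (SUP Q\<in>mcball_of m b r. mdist m Q (g Q))"

definition ball_patches :: "'a metric \<Rightarrow> 'a \<Rightarrow> real \<Rightarrow> ('a set \<times> 'l) set \<Rightarrow> ('a set \<times> 'l) set set"
  where "ball_patches m b r x = {p \<in> patches m x. mcball_of m b r \<subseteq> support p}"

text \<open>If tiles are not connected, a tiling \<open>x\<close> may have no patch whose support contains a large ball
  about \<open>b\<close>, and then \<open>tiling_dist m b \<Gamma> x x > 0\<close>.\<close>

definition tiling_dist ::
    "'a metric \<Rightarrow> 'a \<Rightarrow> ('a \<Rightarrow> 'a) set \<Rightarrow> ('a set \<times> 'l) set \<Rightarrow> ('a set \<times> 'l) set \<Rightarrow> real"
  where "tiling_dist m b \<Gamma> x y = Inf ({1} \<union> {r. r > 0 \<and>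
    (\<exists>p \<in> ball_patches m b (1 / r) x. \<exists>q \<in> ball_patches m b (1 / r) y. \<exists>g\<in>\<Gamma>.
      act g p = q \<and> displacement m b (1 / r) g \<le> r)})"

text \<open>The topology of \<^const>\<open>tiling_dist\<close>, written out as in \<^locale>\<open>Metric_space\<close>, whose axioms
  need not all hold in the situation just described.\<close>

definition tiling_topology ::
    "'a metric \<Rightarrow> 'a \<Rightarrow> ('a \<Rightarrow> 'a) set \<Rightarrow> ('a set \<times> 'l) set set \<Rightarrow> ('a set \<times> 'l) set topology"
  where "tiling_topology m b \<Gamma> \<P> = topology (\<lambda>U. U \<subseteq> tilings m \<P> \<and>
    (\<forall>x\<in>U. \<exists>\<epsilon>>0. \<forall>y\<in>tilings m \<P>. tiling_dist m b \<Gamma> x y < \<epsilon> \<longrightarrow> y \<in> U))"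

lemma openin_tiling_topology:
  "openin (tiling_topology m b \<Gamma> \<P>) U \<longleftrightarrow> U \<subseteq> tilings m \<P> \<and>
    (\<forall>x\<in>U. \<exists>\<epsilon>>0. \<forall>y\<in>tilings m \<P>. tiling_dist m b \<Gamma> x y < \<epsilon> \<longrightarrow> y \<in> U)"
proof -
  have "istopology (\<lambda>U. U \<subseteq> tilings m \<P> \<and>
    (\<forall>x\<in>U. \<exists>\<epsilon>>0. \<forall>y\<in>tilings m \<P>. tiling_dist m b \<Gamma> x y < \<epsilon> \<longrightarrow> y \<in> U))"
    unfolding istopology_def
  proof (intro conjI allI impI ballI; (elim conjE)?)
    fix U V x
    assume "\<forall>x\<in>U. \<exists>\<epsilon>>0. \<forall>y\<in>tilings m \<P>. tiling_dist m b \<Gamma> x y < \<epsilon> \<longrightarrow> y \<in> U"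
      and "\<forall>x\<in>V. \<exists>\<epsilon>>0. \<forall>y\<in>tilings m \<P>. tiling_dist m b \<Gamma> x y < \<epsilon> \<longrightarrow> y \<in> V"
      and "x \<in> U \<inter> V"
    then obtain e e' where "e > 0" "\<And>y. y \<in> tilings m \<P> \<Longrightarrow> tiling_dist m b \<Gamma> x y < e \<Longrightarrow> y \<in> U"
      and "e' > 0" "\<And>y. y \<in> tilings m \<P> \<Longrightarrow> tiling_dist m b \<Gamma> x y < e' \<Longrightarrow> y \<in> V"
      by (metis IntD1 IntD2)
    then show "\<exists>\<epsilon>>0. \<forall>y\<in>tilings m \<P>. tiling_dist m b \<Gamma> x y < \<epsilon> \<longrightarrow> y \<in> U \<inter> V"
      by (intro exI[of _ "min e e'"]) auto
  next
    fix \<U> x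
    assume "\<forall>U\<in>\<U>. U \<subseteq> tilings m \<P> \<and>
        (\<forall>x\<in>U. \<exists>\<epsilon>>0. \<forall>y\<in>tilings m \<P>. tiling_dist m b \<Gamma> x y < \<epsilon> \<longrightarrow> y \<in> U)"
      and "x \<in> \<Union>\<U>"
    then show "\<exists>\<epsilon>>0. \<forall>y\<in>tilings m \<P>. tiling_dist m b \<Gamma> x y < \<epsilon> \<longrightarrow> y \<in> \<Union>\<U>"
      by (meson Union_iff)
  qed blast+
  then show ?thesis
    by (simp add: tiling_topology_def)
qed

lemma topspace_tiling_topology [simp]: "topspace (tiling_topology m b \<Gamma> \<P>) = tilings m \<P>"
proof
  show "topspace (tiling_topology m b \<Gamma> \<P>) \<subseteq> tilings m \<P>"
    by (metis openin_tiling_topology openin_topspace)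
  have "openin (tiling_topology m b \<Gamma> \<P>) (tilings m \<P>)"
    unfolding openin_tiling_topology by (auto intro: exI[of _ 1])
  then show "tilings m \<P> \<subseteq> topspace (tiling_topology m b \<Gamma> \<P>)"
    by (rule openin_subset)
qed


section \<open>The hull, minimality and repetitivity\<close>

definition tiling_orbit :: "('a \<Rightarrow> 'a) set \<Rightarrow> ('a set \<times> 'l) set \<Rightarrow> ('a set \<times> 'l) set set"
  where "tiling_orbit \<Gamma> x = (\<lambda>g. act g x) ` \<Gamma>"

definition tiling_hull ::
    "'a metric \<Rightarrow> 'a \<Rightarrow> ('a \<Rightarrow> 'a) set \<Rightarrow> ('a set \<times> 'l) set set \<Rightarrow> ('a set \<times> 'l) set \<Rightarrow> ('a set \<times> 'l) set set"
  where "tiling_hull m b \<Gamma> \<P> x = tiling_topology m b \<Gamma> \<P> closure_of tiling_orbit \<Gamma> x"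

definition minimal_hull ::
    "'a metric \<Rightarrow> 'a \<Rightarrow> ('a \<Rightarrow> 'a) set \<Rightarrow> ('a set \<times> 'l) set set \<Rightarrow> ('a set \<times> 'l) set \<Rightarrow> bool"
  where "minimal_hull m b \<Gamma> \<P> x \<longleftrightarrow> (\<forall>y \<in> tiling_hull m b \<Gamma> \<P> x.
    subtopology (tiling_topology m b \<Gamma> \<P>) (tiling_hull m b \<Gamma> \<P> x) closure_of tiling_orbit \<Gamma> y = tiling_hull m b \<Gamma> \<P> x)"

definition repetitive :: "'a metric \<Rightarrow> ('a \<Rightarrow> 'a) set \<Rightarrow> ('a set \<times> 'l) set \<Rightarrow> bool"
  where "repetitive m \<Gamma> x \<longleftrightarrow> (\<forall>p \<in> patches m x. \<exists>r>0. \<forall>c \<in> mspace m. \<exists>g\<in>\<Gamma>.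
    act g p \<subseteq> x \<and> support (act g p) \<subseteq> mcball_of m c r)"

end

theory Submission
  imports Defs
begin

text \<open>The link between the topology and the combinatorics is that a patch of a tiling \<open>y\<close> whose
  support contains a region must contain every nonempty tile of \<open>y\<close> lying in that region, since
  tiles are closures of their interiors and distinct tiles have disjoint interiors
  (\<open>tile_in_cover\<close>). Hence a tiling close to \<open>y\<close> contains a copy of any prescribed bounded part of
  \<open>y\<close>, moved by little (\<open>copy_in_near_tiling\<close>). Moreover \<open>\<Gamma>\<close> acts continuously on the space of
  tilings (\<open>continuous_act\<close>), so hulls are invariant.

  (i) A vanishing distance from \<open>x\<close> to itself means that \<open>x\<close> has patches covering arbitrarily
  large balls. This property, and the property that every patch has a copy in \<open>x\<close>, are closed and
  hold on the orbit of \<open>x\<close>, hence at each \<open>y\<close> in the hull (\<open>hull_big_patches\<close>,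
  \<open>hull_patch_copy\<close>). Let \<open>p\<close> be a patch of \<open>x\<close> around a large ball, and let \<open>R\<close> be such that every
  ball of radius \<open>R\<close> contains a copy of \<open>p\<close>. A patch of \<open>y\<close> covering a ball of radius \<open>R\<close> has a copy
  in \<open>x\<close>, inside which there is a copy of \<open>p\<close>; so \<open>p\<close> occurs in \<open>y\<close>, and some image of \<open>y\<close> agrees
  with \<open>x\<close> on \<open>p\<close>. Thus \<open>x\<close> lies in the hull of \<open>y\<close> (\<open>repetitive_in_hull\<close>), which is minimality.

  (ii) Fix a patch \<open>p\<close> of \<open>x\<close>. The tilings with a copy of \<open>p\<close> within radius less than \<open>n\<close> of the base
  point form an open set, increasing with \<open>n\<close>; by minimality these sets cover the hull
  (\<open>minimal_hull_has_copies\<close>), and by compactness one of them, of radius \<open>N\<close>, does. Applied to the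
  tilings in the orbit of \<open>x\<close>, this gives copies of \<open>p\<close> in \<open>x\<close> near every point of the orbit of the
  base point. That orbit is relatively dense because finitely many compact prototiles tile the
  space (\<open>orbit_of_base_relatively_dense\<close>), so copies of \<open>p\<close> occur at bounded distance from every
  point.

  The empty set is a tile, and no covering condition can detect it; the comparison of patches
  therefore concerns their nonempty tiles only. Empty tiles are restored at the end, since every
  isometry fixes them (\<open>act_subset_iff_solid\<close>).\<close>

section \<open>Labelled tiles under isometries\<close>

text \<open>The part of a collection of tiles that a covering condition can detect.\<close>

definition solid :: "('a set \<times> 'l) set \<Rightarrow> ('a set \<times> 'l) set"
  where "solid p = {s \<in> p. fst s \<noteq> {}}"

lemma support_solid [simp]: "support (solid p) = support p"
  by (auto simp: support_def solid_def)

lemma solid_subset: "solid p \<subseteq> p"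
  by (auto simp: solid_def)

lemma patches_solid: "p \<in> patches m x \<Longrightarrow> solid p \<in> patches m x"
  using solid_subset[of p] by (auto simp: patches_def intro: finite_subset)

lemma solid_act: "solid (act g p) = act g (solid p)"
  by (force simp: act_def solid_def)

lemma support_act: "support (act g p) = g ` support p"
  by (force simp: act_def support_def)

lemma act_mono: "p \<subseteq> q \<Longrightarrow> act g p \<subseteq> act g q"
  by (auto simp: act_def)

lemma act_union: "act g (p \<union> q) = act g p \<union> act g q"
  by (auto simp: act_def)

text \<open>The image of an empty tile is the same empty tile, which already belongs to \<open>x\<close>; so only the
  nonempty tiles can obstruct copying \<open>p\<close>.\<close>

lemma act_subset_iff_solid:
  assumes "p \<subseteq> x"
  shows "act g p \<subseteq> x \<longleftrightarrow> act g (solid p) \<subseteq> x"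
proof
  assume *: "act g (solid p) \<subseteq> x"
  have "act g {s \<in> p. fst s = {}} \<subseteq> p"
    by (force simp: act_def)
  moreover have "act g p = act g (solid p) \<union> act g {s \<in> p. fst s = {}}"
    unfolding act_union[symmetric] by (rule arg_cong[where f = "act g"]) (auto simp: solid_def)
  ultimately show "act g p \<subseteq> x"
    using * assms by blast
qed (use act_mono[OF solid_subset] in blast)

lemma act_congruent:
  assumes "support p \<subseteq> A" "\<And>u. u \<in> A \<Longrightarrow> g u = h u"
  shows "act g p = act h p"
proof -
  have "g ` S = h ` S" if "(S, a) \<in> p" for S a
    using assms that by (intro image_cong) (auto simp: support_def)
  then have "(\<lambda>(S, a). (g ` S, a)) s = (\<lambda>(S, a). (h ` S, a)) s" if "s \<in> p" for s
    using that by (cases s) simp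
  then show ?thesis
    unfolding act_def by (rule image_cong[OF refl])
qed

lemma act_act: "act g (act h p) = act (g \<circ> h) p"
  by (simp add: act_def image_image case_prod_beta comp_def)

lemma act_id: "act id p = p"
  by (simp add: act_def)

text \<open>Elements of \<open>\<Gamma>\<close> are extensional functions with composition restricted to the space, so
  identity, products and inverses are described below by their values on the space. That
  determines their action on tiles contained in it.\<close>

locale tiling_system =
  fixes m :: "'a metric" and b :: 'a and \<Gamma> :: "('a \<Rightarrow> 'a) set"
    and \<P> :: "('a set \<times> 'l) set set"
  assumes base: "b \<in> mspace m"
    and group: "subgroup \<Gamma> (isom_group m)"
    and prototile_set: "\<P> \<subseteq> prototiles m \<Gamma>"
begin

sublocale Metric_space "mspace m" "mdist m"
  by (rule Metric_space_mspace_mdist)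

lemma isometry_of: "g \<in> \<Gamma> \<Longrightarrow> g \<in> isometries m"
  using subgroup.subset[OF group] by (auto simp: isom_group_def)

lemma image_space: "g \<in> \<Gamma> \<Longrightarrow> g ` mspace m = mspace m"
  using isometry_of by (force simp: isometries_def Bij_def bij_betw_def)

lemma in_space: "g \<in> \<Gamma> \<Longrightarrow> u \<in> mspace m \<Longrightarrow> g u \<in> mspace m"
  using image_space by blast

lemma dist_invariant:
  "g \<in> \<Gamma> \<Longrightarrow> u \<in> mspace m \<Longrightarrow> v \<in> mspace m \<Longrightarrow> mdist m (g u) (g v) = mdist m u v"
  using isometry_of by (auto simp: isometries_def)

lemma identity_element:
  obtains e where "e \<in> \<Gamma>" "\<And>u. u \<in> mspace m \<Longrightarrow> e u = u"
proof
  show "(\<lambda>u\<in>mspace m. u) \<in> \<Gamma>"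
    using subgroup.one_closed[OF group] by (simp add: isom_group_def BijGroup_def)
qed simp

lemma composition_element:
  assumes "g \<in> \<Gamma>" "h \<in> \<Gamma>"
  obtains k where "k \<in> \<Gamma>" "\<And>u. u \<in> mspace m \<Longrightarrow> k u = g (h u)"
proof
  have "g \<in> Bij (mspace m)" "h \<in> Bij (mspace m)"
    using assms isometry_of by (auto simp: isometries_def)
  then show "compose (mspace m) g h \<in> \<Gamma>"
    using subgroup.m_closed[OF group assms] by (simp add: isom_group_def BijGroup_def)
qed (simp add: compose_eq)

lemma inverse_element:
  assumes g: "g \<in> \<Gamma>"
  obtains h where "h \<in> \<Gamma>" "\<And>u. u \<in> mspace m \<Longrightarrow> h (g u) = u"
    "\<And>u. u \<in> mspace m \<Longrightarrow> g (h u) = u"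
proof -
  interpret G: group "isom_group m" by (rule group_isom_group)
  define h where "h = inv\<^bsub>isom_group m\<^esub> g"
  have h: "h \<in> \<Gamma>"
    unfolding h_def by (rule subgroup.m_inv_closed[OF group g])
  have B: "g \<in> Bij (mspace m)" "h \<in> Bij (mspace m)"
    using g h isometry_of by (auto simp: isometries_def)
  have "h \<otimes>\<^bsub>isom_group m\<^esub> g = \<one>\<^bsub>isom_group m\<^esub>"
    unfolding h_def using g subgroup.mem_carrier[OF group] by (intro G.l_inv) auto
  then have *: "compose (mspace m) h g = (\<lambda>u\<in>mspace m. u)"
    using B by (simp add: isom_group_def BijGroup_def)
  have hg: "h (g u) = u" if "u \<in> mspace m" for u
    using fun_cong[OF *, of u] that by (simp add: compose_eq)
  moreover have "g (h u) = u" if "u \<in> mspace m" for u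
    using image_space[OF g] that hg by force
  ultimately show thesis
    using h that by blast
qed

lemma homeomorphic: "g \<in> \<Gamma> \<Longrightarrow> homeomorphic_map mtopology mtopology g"
  by (intro Metric_space12.isometry_imp_homeomorphic_map)
     (auto simp: Metric_space12_mspace_mdist image_space dist_invariant)

lemma tile_image:
  assumes g: "g \<in> \<Gamma>" and S: "tile m S"
  shows "tile m (g ` S)"
proof -
  have sub: "S \<subseteq> topspace mtopology" "mtopology interior_of S \<subseteq> topspace mtopology"
    using S compactin_subset_topspace[of mtopology S]
    by (auto simp only: tile_def mtopology_of_def interior_of_subset_topspace)
  have "compactin mtopology (g ` S)"
    using S homeomorphic_imp_continuous_map[OF homeomorphic[OF g]]
    by (intro image_compactin) (auto simp: tile_def mtopology_of_def)
  moreover have "mtopology closure_of (mtopology interior_of (g ` S)) = g ` S"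
    using S homeomorphic_map_interior_of[OF homeomorphic[OF g] sub(1)]
      homeomorphic_map_closure_of[OF homeomorphic[OF g] sub(2)]
    by (simp add: tile_def mtopology_of_def)
  ultimately show ?thesis
    by (simp add: tile_def mtopology_of_def)
qed


section \<open>Tilings and their patches\<close>

lemma prototile_tile: "s \<in> \<Union>\<P> \<Longrightarrow> tile m (fst s)"
  using prototile_set by (fastforce simp: prototiles_def quotient_def tile_equiv_def labelled_tiles_def)

lemma prototile_image:
  assumes g: "g \<in> \<Gamma>" and s: "(S, a) \<in> \<Union>\<P>"
  shows "(g ` S, a) \<in> \<Union>\<P>"
proof -
  obtain X where X: "X \<in> \<P>" "(S, a) \<in> X" using s by blast
  with prototile_set obtain T c where T: "(T, c) \<in> labelled_tiles m" "X = tile_equiv m \<Gamma> `` {(T, c)}"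
    by (fastforce simp: prototiles_def quotient_def)
  with X(2) obtain h where h: "h \<in> \<Gamma>" "S = h ` T" "c = a"
    by (auto simp: tile_equiv_def)
  obtain k where k: "k \<in> \<Gamma>" "\<And>u. u \<in> mspace m \<Longrightarrow> k u = g (h u)"
    using composition_element[OF g h(1)] by blast
  have "T \<subseteq> mspace m"
    using T(1) compactin_subset_topspace by (fastforce simp: labelled_tiles_def tile_def)
  then have gS: "g ` S = k ` T"
    unfolding h(2) image_image using k(2) by (intro image_cong) auto
  have "(k ` T, a) \<in> labelled_tiles m"
    using tile_image[OF k(1)] T(1) by (auto simp: labelled_tiles_def)
  then have "(g ` S, a) \<in> X"
    using T h(3) k(1) by (auto simp: gS tile_equiv_def)
  then show ?thesis using X(1) by blast
qed

lemma tiling_tile: "x \<in> tilings m \<P> \<Longrightarrow> s \<in> x \<Longrightarrow> tile m (fst s)"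
  by (rule prototile_tile) (auto simp only: tilings_def mem_Collect_eq)

lemma support_subset: "x \<in> tilings m \<P> \<Longrightarrow> p \<subseteq> x \<Longrightarrow> support p \<subseteq> mspace m"
  unfolding tilings_def support_def by blast

lemma act_tiling:
  assumes g: "g \<in> \<Gamma>" and x: "x \<in> tilings m \<P>"
  shows "act g x \<in> tilings m \<P>"
proof -
  have "act g x \<subseteq> \<Union>\<P>"
    using x prototile_image[OF g] by (fastforce simp: tilings_def act_def)
  have "support (act g x) = mspace m"
    using x image_space[OF g] by (simp add: support_act tilings_def)
  have *: "disjnt (mtopology interior_of (g ` fst s)) (mtopology interior_of (g ` fst t))"
    if st: "s \<in> x" "t \<in> x" "s \<noteq> t" for s t
  proof -
    have sub: "fst s \<subseteq> topspace mtopology" "fst t \<subseteq> topspace mtopology"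
      using x st by (force simp: tilings_def support_def)+
    have "mtopology interior_of fst s \<subseteq> mspace m" "mtopology interior_of fst t \<subseteq> mspace m"
      using sub interior_of_subset by fastforce+
    moreover have "inj_on g (mspace m)"
      using isometry_of[OF g] by (auto simp: isometries_def Bij_def bij_betw_def)
    moreover have "disjnt (mtopology interior_of fst s) (mtopology interior_of fst t)"
      using x st by (auto simp: tilings_def mtopology_of_def)
    ultimately show ?thesis
      unfolding homeomorphic_map_interior_of[OF homeomorphic[OF g] sub(1)]
        homeomorphic_map_interior_of[OF homeomorphic[OF g] sub(2)]
      by (force simp: disjnt_def inj_on_def)
  qed
  have disj: "disjnt (mtopology interior_of fst s') (mtopology interior_of fst t')"
    if st: "s' \<in> act g x" "t' \<in> act g x" "s' \<noteq> t'" for s' t'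
  proof -
    obtain s t where "s \<in> x" "t \<in> x" "s' = (g ` fst s, snd s)" "t' = (g ` fst t, snd t)"
      using st(1,2) by (auto simp: act_def)
    moreover from this have "s \<noteq> t"
      using st(3) by blast
    ultimately show ?thesis
      using * by simp
  qed
  show ?thesis
    using \<open>act g x \<subseteq> \<Union>\<P>\<close> \<open>support (act g x) = mspace m\<close> disj
    by (simp add: tilings_def mtopology_of_def)
qed

lemma act_composition:
  assumes gh: "g \<in> \<Gamma>" "h \<in> \<Gamma>"
  obtains k where "k \<in> \<Gamma>" "\<And>u. u \<in> mspace m \<Longrightarrow> k u = g (h u)"
    "\<And>p :: ('a set \<times> 'l) set. support p \<subseteq> mspace m \<Longrightarrow> act k p = act g (act h p)"
proof -
  obtain k where k: "k \<in> \<Gamma>" "\<And>u. u \<in> mspace m \<Longrightarrow> k u = g (h u)"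
    using composition_element[OF gh] by blast
  have "act k p = act g (act h p)" if "support p \<subseteq> mspace m" for p :: "('a set \<times> 'l) set"
    unfolding act_act by (rule act_congruent[OF that]) (simp add: k(2))
  then show thesis using that k by blast
qed

lemma act_inverse:
  assumes g: "g \<in> \<Gamma>"
  obtains h where "h \<in> \<Gamma>" "\<And>u. u \<in> mspace m \<Longrightarrow> h (g u) = u"
    "\<And>u. u \<in> mspace m \<Longrightarrow> g (h u) = u"
    "\<And>p :: ('a set \<times> 'l) set. support p \<subseteq> mspace m \<Longrightarrow> act h (act g p) = p"
    "\<And>p :: ('a set \<times> 'l) set. support p \<subseteq> mspace m \<Longrightarrow> act g (act h p) = p"
proof -
  obtain h where h: "h \<in> \<Gamma>" "\<And>u. u \<in> mspace m \<Longrightarrow> h (g u) = u"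
      "\<And>u. u \<in> mspace m \<Longrightarrow> g (h u) = u"
    using inverse_element[OF g] by blast
  have "act h (act g p) = p" "act g (act h p) = p" if "support p \<subseteq> mspace m"
    for p :: "('a set \<times> 'l) set"
    using act_congruent[OF that, of "h \<circ> g" id] act_congruent[OF that, of "g \<circ> h" id] h
    by (simp_all only: act_act act_id comp_apply id_apply)
  then show thesis using that h by blast
qed

lemma act_identity:
  obtains e where "e \<in> \<Gamma>" "\<And>u. u \<in> mspace m \<Longrightarrow> e u = u"
    "\<And>p :: ('a set \<times> 'l) set. support p \<subseteq> mspace m \<Longrightarrow> act e p = p"
proof -
  obtain e where e: "e \<in> \<Gamma>" "\<And>u. u \<in> mspace m \<Longrightarrow> e u = u"
    using identity_element by blast
  have "act e p = p" if "support p \<subseteq> mspace m" for p :: "('a set \<times> 'l) set"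
    using act_congruent[OF that, of e id] e(2) by (simp only: act_id id_apply)
  then show thesis using that e by blast
qed

lemma act_patch:
  assumes g: "g \<in> \<Gamma>" and p: "p \<in> patches m x" "act g p \<subseteq> y"
  shows "act g p \<in> patches m y"
proof -
  have "connectedin mtopology (g ` support p)"
    using p homeomorphic_imp_continuous_map[OF homeomorphic[OF g]]
    by (intro connectedin_continuous_map_image) (auto simp: patches_def mtopology_of_def)
  then show ?thesis
    using p by (auto simp: patches_def support_act mtopology_of_def) (auto simp: act_def)
qed

lemma compact_bounded:
  assumes "compactin mtopology S"
  obtains R where "R > 0" "S \<subseteq> mcball b R"
proof -
  obtain c B where c: "S \<subseteq> mcball c B"
    using compactin_imp_mbounded[OF assms] by (auto simp: mbounded_def)
  have "S \<subseteq> mcball b (max 1 (mdist m b c + B))"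
  proof
    fix u assume "u \<in> S"
    then have "u \<in> mcball c B" using c by blast
    then show "u \<in> mcball b (max 1 (mdist m b c + B))"
      using base triangle[of b c u] by auto
  qed
  then show thesis using that[of "max 1 (mdist m b c + B)"] by simp
qed

lemma patch_bounded:
  assumes x: "x \<in> tilings m \<P>" and p: "p \<in> patches m x"
  obtains R where "R > 0" "support p \<subseteq> mcball b R"
proof -
  have "compactin mtopology (fst s)" if "s \<in> p" for s
    using tiling_tile[OF x, of s] that p by (auto simp: patches_def tile_def mtopology_of_def)
  moreover have "finite p" "support p = \<Union>(fst ` p)"
    using p by (auto simp: patches_def support_def)
  ultimately have "compactin mtopology (support p)"
    by (auto intro!: compactin_Union)
  then show thesis
    using compact_bounded that by blast
qed

text \<open>The interior of \<open>s\<close> meets some tile \<open>t\<close> of \<open>q\<close>. Being open, it then meets the interior of \<open>t\<close>,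
  whose closure is \<open>t\<close>, and disjointness of interiors forces \<open>s = t\<close>.\<close>

lemma tile_in_cover:
  assumes x: "x \<in> tilings m \<P>" and q: "q \<subseteq> x" and s: "s \<in> x" "fst s \<noteq> {}" "fst s \<subseteq> support q"
  shows "s \<in> q"
proof -
  let ?I = "\<lambda>S. mtopology interior_of S"
  have tile: "fst t = mtopology closure_of (?I (fst t))" if "t \<in> x" for t
    using tiling_tile[OF x that] by (simp add: tile_def mtopology_of_def)
  then have "?I (fst s) \<noteq> {}"
    using s by (metis closure_of_empty)
  then obtain u where u: "u \<in> ?I (fst s)" by blast
  then obtain t where t: "t \<in> q" "u \<in> fst t"
    using s(3) interior_of_subset[of mtopology "fst s"] by (fastforce simp: support_def)
  have "u \<in> mtopology closure_of (?I (fst t))"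
    using tile t q by blast
  then have "?I (fst s) \<inter> ?I (fst t) \<noteq> {}"
    using u openin_interior_of[of mtopology "fst s"] by (fastforce simp: in_closure_of)
  moreover have "s \<noteq> t \<Longrightarrow> disjnt (?I (fst s)) (?I (fst t))"
    using x s(1) t(1) q unfolding tilings_def mtopology_of_def by blast
  ultimately have "s = t"
    by (auto simp: disjnt_def)
  then show ?thesis using t by simp
qed

lemma patch_in_cover:
  assumes "x \<in> tilings m \<P>" "q \<subseteq> x" "p \<subseteq> x" "support p \<subseteq> support q"
  shows "solid p \<subseteq> q"
proof
  fix s assume "s \<in> solid p"
  then have s: "s \<in> p" "fst s \<noteq> {}"
    by (auto simp: solid_def)
  then have "fst s \<subseteq> support p"
    by (cases s) (auto simp: support_def)
  then show "s \<in> q"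
    using tile_in_cover[of x q s] assms s by blast
qed


section \<open>Near tilings\<close>

lemma ball_patches_antimono:
  assumes "R \<le> R'" "p \<in> ball_patches m b R' x"
  shows "p \<in> ball_patches m b R x"
  using assms mcball_subset_concentric[OF assms(1), of b] by (auto simp: ball_patches_def mcball_of_def)

lemma isometry_pulls_ball:
  assumes h: "h \<in> \<Gamma>" "v \<in> mspace m" "h v \<in> mcball b r"
  shows "v \<in> mcball b (r + mdist m b (h b))"
proof -
  have "mdist m b v = mdist m (h b) (h v)"
    using h base by (simp add: dist_invariant)
  also have "\<dots> \<le> mdist m (h b) b + mdist m b (h v)"
    using h base by (intro triangle) (auto simp: in_space)
  finally show ?thesis
    using h base by (auto simp: commute)
qed

text \<open>Moving a patch by \<open>h\<close> moves the centre of the ball it covers to \<open>h b\<close>, so the radius about \<open>b\<close>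
  decreases by at most the distance from \<open>b\<close> to \<open>h b\<close>.\<close>

lemma ball_patches_act:
  assumes h: "h \<in> \<Gamma>" and p: "p \<in> ball_patches m b (R + mdist m b (h b)) x"
  shows "act h p \<in> ball_patches m b R (act h x)"
proof -
  have "mcball b R \<subseteq> h ` support p"
  proof
    fix u assume u: "u \<in> mcball b R"
    then obtain v where v: "v \<in> mspace m" "u = h v"
      using image_space[OF h] by (auto simp del: image_eqI)
    then have "v \<in> support p"
      using isometry_pulls_ball[OF h v(1)] u p by (auto simp: ball_patches_def mcball_of_def)
    then show "u \<in> h ` support p"
      using v(2) by blast
  qed
  moreover have "act h p \<in> patches m (act h x)"
    using p by (intro act_patch[OF h] act_mono) (auto simp: ball_patches_def patches_def)
  ultimately show ?thesis
    by (simp add: ball_patches_def mcball_of_def support_act)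
qed

text \<open>The supremum defining \<^const>\<open>displacement\<close> is over a nonempty set that is bounded above, so it
  may be replaced by a pointwise bound.\<close>

lemma displacement_le_iff:
  assumes g: "g \<in> \<Gamma>" and r: "r > 0"
  shows "displacement m b r g \<le> e \<longleftrightarrow> (\<forall>u\<in>mcball b r. mdist m u (g u) \<le> e)"
proof -
  have "mdist m u (g u) \<le> r + mdist m b (g b) + r" if "u \<in> mcball b r" for u
    using that base triangle[of u b "g u"] triangle[of b "g b" "g u"]
    by (auto simp: in_space g dist_invariant commute)
  then have "bdd_above ((\<lambda>u. mdist m u (g u)) ` mcball b r)"
    by (rule bdd_aboveI2)
  moreover have "mcball b r \<noteq> {}"
    using base r centre_in_mcball_iff[of b r] by fastforce
  ultimately show ?thesis
    by (simp add: displacement_def mcball_of_def cSUP_le_iff)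
qed

lemma tiling_dist_leI:
  assumes r: "r > 0" and p: "p \<in> ball_patches m b (1 / r) x"
    and g: "g \<in> \<Gamma>" "act g p \<in> ball_patches m b (1 / r) y"
    and d: "\<And>u. u \<in> mcball b (1 / r) \<Longrightarrow> mdist m u (g u) \<le> r"
  shows "tiling_dist m b \<Gamma> x y \<le> r"
  unfolding tiling_dist_def
proof (rule cInf_lower)
  show "bdd_below ({1} \<union> {r. r > 0 \<and> (\<exists>p \<in> ball_patches m b (1 / r) x.
      \<exists>q \<in> ball_patches m b (1 / r) y. \<exists>g\<in>\<Gamma>. act g p = q \<and> displacement m b (1 / r) g \<le> r)})"
    by (intro bdd_belowI[of _ 0]) auto
  have "displacement m b (1 / r) g \<le> r"
    using displacement_le_iff[OF g(1), of "1 / r" r] r d by auto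
  then show "r \<in> {1} \<union> {r. r > 0 \<and> (\<exists>p \<in> ball_patches m b (1 / r) x.
      \<exists>q \<in> ball_patches m b (1 / r) y. \<exists>g\<in>\<Gamma>. act g p = q \<and> displacement m b (1 / r) g \<le> r)}"
    using r p g by blast
qed

text \<open>The condition on \<open>r\<close> in \<^const>\<open>tiling_dist\<close> weakens as \<open>r\<close> grows, because the ball of radius
  \<open>1 / r\<close> shrinks. A witness below \<open>e\<close> therefore gives one at \<open>e\<close>; the bound \<open>e \<le> 1\<close> excludes the
  default value 1 of the infimum.\<close>

lemma tiling_dist_lessD:
  assumes e: "tiling_dist m b \<Gamma> x y < e" "e \<le> 1"
  obtains p g where "p \<in> ball_patches m b (1 / e) x" "g \<in> \<Gamma>"
    "act g p \<in> ball_patches m b (1 / e) y"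
    "\<And>u. u \<in> mcball b (1 / e) \<Longrightarrow> mdist m u (g u) \<le> e"
proof -
  obtain r p g where r: "0 < r" "r < e" and p: "p \<in> ball_patches m b (1 / r) x"
    and g: "g \<in> \<Gamma>" "act g p \<in> ball_patches m b (1 / r) y" "displacement m b (1 / r) g \<le> r"
    using cInf_lessD[OF _ e(1)[unfolded tiling_dist_def]] e(2) by auto
  have sub: "mcball b (1 / e) \<subseteq> mcball b (1 / r)"
    using r by (intro mcball_subset_concentric) (simp add: frac_le)
  have mono: "q \<in> ball_patches m b (1 / e) z" if "q \<in> ball_patches m b (1 / r) z" for q z
    using r by (intro ball_patches_antimono[OF _ that]) (simp add: frac_le)
  have "mdist m u (g u) \<le> e" if "u \<in> mcball b (1 / e)" for u
    using that sub displacement_le_iff[OF g(1), of "1 / r" r] g(3) r by force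
  with p g mono that show thesis by blast
qed

text \<open>The patch of \<open>y\<close> that witnesses the small distance covers the ball of radius \<open>R\<close>, so it
  contains the nonempty tiles of \<open>p\<close> and carries them along into \<open>z\<close>.\<close>

lemma copy_in_near_tiling:
  assumes y: "y \<in> tilings m \<P>" and p: "p \<subseteq> y" "support p \<subseteq> mcball b R"
    and e: "tiling_dist m b \<Gamma> y z < e" "e \<le> 1" "R \<le> 1 / e"
  obtains g where "g \<in> \<Gamma>" "act g (solid p) \<subseteq> z" "\<And>u. u \<in> mcball b R \<Longrightarrow> mdist m u (g u) \<le> e"
proof -
  obtain q g where q: "q \<in> ball_patches m b (1 / e) y" and g: "g \<in> \<Gamma>"
    "act g q \<in> ball_patches m b (1 / e) z" "\<And>u. u \<in> mcball b (1 / e) \<Longrightarrow> mdist m u (g u) \<le> e"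
    using tiling_dist_lessD[OF e(1,2)] by metis
  have sub: "mcball b R \<subseteq> mcball b (1 / e)"
    by (rule mcball_subset_concentric[OF e(3)])
  have "solid p \<subseteq> q"
    using q p sub by (intro patch_in_cover[OF y]) (auto simp: ball_patches_def patches_def mcball_of_def)
  then have "act g (solid p) \<subseteq> act g q"
    by (rule act_mono)
  also have "act g q \<subseteq> z"
    using g(2) by (simp add: ball_patches_def patches_def)
  finally show thesis
    using g(1,3) sub by (intro that) auto
qed

lemma reciprocal_radius:
  fixes R e :: real
  assumes "e > 0"
  obtains d where "0 < d" "d \<le> 1" "d \<le> e" "R \<le> 1 / d"
proof
  let ?d = "min 1 (min e (1 / max 1 R))"
  have "1 / (1 / max 1 R) \<le> 1 / ?d"
    using assms by (intro divide_left_mono) auto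
  then show "R \<le> 1 / ?d"
    by auto
qed (use assms in auto)

text \<open>If \<open>g\<close> carries a patch of \<open>z\<close> to one of \<open>w\<close>, then the conjugate of \<open>g\<close> by \<open>h\<close> carries the
  \<open>h\<close>-image of the first to that of the second. It displaces each point as far as \<open>g\<close>
  displaces the preimage under \<open>h\<close>, which lies in a ball about \<open>b\<close> larger by the distance from
  \<open>b\<close> to \<open>h b\<close>.\<close>

lemma continuous_act:
  assumes h: "h \<in> \<Gamma>"
  shows "continuous_map (tiling_topology m b \<Gamma> \<P>) (tiling_topology m b \<Gamma> \<P>) (act h)"
  unfolding continuous_map_def topspace_tiling_topology
proof (intro conjI allI impI)
  show "act h \<in> tilings m \<P> \<rightarrow> tilings m \<P>"
    using act_tiling[OF h] by blast
next
  fix U assume U: "openin (tiling_topology m b \<Gamma> \<P>) U"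
  obtain h' where h': "h' \<in> \<Gamma>" "\<And>u. u \<in> mspace m \<Longrightarrow> h' (h u) = u"
    "\<And>u. u \<in> mspace m \<Longrightarrow> h (h' u) = u"
    "\<And>p :: ('a set \<times> 'l) set. support p \<subseteq> mspace m \<Longrightarrow> act h' (act h p) = p"
    using act_inverse[OF h] by metis
  show "openin (tiling_topology m b \<Gamma> \<P>) {z \<in> tilings m \<P>. act h z \<in> U}"
    unfolding openin_tiling_topology
  proof (intro conjI ballI)
    fix z assume "z \<in> {z \<in> tilings m \<P>. act h z \<in> U}"
    then have z: "z \<in> tilings m \<P>" "act h z \<in> U" by auto
    then obtain e where e: "e > 0"
      and eU: "\<And>w. w \<in> tilings m \<P> \<Longrightarrow> tiling_dist m b \<Gamma> (act h z) w < e \<Longrightarrow> w \<in> U"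
      using U unfolding openin_tiling_topology by metis
    obtain r where r: "0 < r" "r < e"
      using dense[OF e] by blast
    obtain d where d: "0 < d" "d \<le> 1" "d \<le> r" and dR: "1 / r + mdist m b (h b) \<le> 1 / d"
      using reciprocal_radius[OF r(1)] by metis
    have pull: "h' u \<in> mcball b (1 / d)" if "u \<in> mcball b (1 / r)" for u
      using isometry_pulls_ball[OF h, of "h' u" "1 / r"] that h'(3)[of u] in_space[OF h'(1)] dR
      by auto
    have move: "act h p \<in> ball_patches m b (1 / r) (act h w)"
      if "p \<in> ball_patches m b (1 / d) w" for p w
      using ball_patches_act[OF h] ball_patches_antimono[OF dR that] .
    have "act h w \<in> U" if w: "w \<in> tilings m \<P>" "tiling_dist m b \<Gamma> z w < d" for w
    proof -
      obtain p g where p: "p \<in> ball_patches m b (1 / d) z" and g: "g \<in> \<Gamma>"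
        "act g p \<in> ball_patches m b (1 / d) w"
        "\<And>u. u \<in> mcball b (1 / d) \<Longrightarrow> mdist m u (g u) \<le> d"
        using tiling_dist_lessD[OF w(2) d(2)] by metis
      \<comment> \<open>the conjugate of \<open>g\<close> by \<open>h\<close>\<close>
      obtain k where k: "k \<in> \<Gamma>" "\<And>u. u \<in> mspace m \<Longrightarrow> k u = h (g (h' u))"
        by (metis composition_element g(1) h h'(1) in_space)
      have ps: "support p \<subseteq> mspace m"
        using p z support_subset by (auto simp: ball_patches_def patches_def)
      have "act k (act h p) = act h (act g p)"
      proof -
        have "act k (act h p) = act (h \<circ> g \<circ> h') (act h p)"
          using ps in_space[OF h] k(2) by (intro act_congruent[of _ "mspace m"]) (auto simp: support_act)
        also have "\<dots> = act h (act g (act h' (act h p)))"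
          by (simp add: act_act o_assoc)
        finally show ?thesis
          using h'(4) ps by simp
      qed
      then have "act k (act h p) \<in> ball_patches m b (1 / r) (act h w)"
        using move[OF g(2)] by simp
      moreover have "mdist m u (k u) \<le> r" if u: "u \<in> mcball b (1 / r)" for u
      proof -
        have "mdist m u (k u) = mdist m (h (h' u)) (h (g (h' u)))"
          using u k(2) h'(3) by simp
        also have "\<dots> = mdist m (h' u) (g (h' u))"
          using u in_space[OF h'(1)] in_space[OF g(1)] by (intro dist_invariant[OF h]) auto
        also have "\<dots> \<le> r"
          using g(3)[OF pull[OF u]] d(3) by simp
        finally show ?thesis .
      qed
      ultimately have "tiling_dist m b \<Gamma> (act h z) (act h w) \<le> r"
        using k(1) move[OF p] r(1) by (intro tiling_dist_leI)
      then show ?thesis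
        using eU act_tiling[OF h w(1)] r(2) by force
    qed
    then show "\<exists>d>0. \<forall>w\<in>tilings m \<P>. tiling_dist m b \<Gamma> z w < d \<longrightarrow>
        w \<in> {z \<in> tilings m \<P>. act h z \<in> U}"
      using d(1) by blast
  qed auto
qed

lemma closedin_tiling_topologyI:
  assumes C: "C \<subseteq> tilings m \<P>"
    and far: "\<And>y. y \<in> tilings m \<P> \<Longrightarrow> y \<notin> C \<Longrightarrow>
      \<exists>e>0. \<forall>z\<in>C. tiling_dist m b \<Gamma> y z \<ge> e"
  shows "closedin (tiling_topology m b \<Gamma> \<P>) C"
  unfolding closedin_def openin_tiling_topology topspace_tiling_topology
proof (intro conjI C ballI)
  fix y assume "y \<in> tilings m \<P> - C"
  then obtain e where e: "e > 0" "\<forall>z\<in>C. tiling_dist m b \<Gamma> y z \<ge> e"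
    using far by auto
  then have "z \<in> tilings m \<P> - C" if "z \<in> tilings m \<P>" "tiling_dist m b \<Gamma> y z < e" for z
    using that by fastforce
  then show "\<exists>e>0. \<forall>z\<in>tilings m \<P>. tiling_dist m b \<Gamma> y z < e \<longrightarrow> z \<in> tilings m \<P> - C"
    using e(1) by blast
qed blast


section \<open>The hull of a tiling\<close>

lemma orbit_tiling: "x \<in> tilings m \<P> \<Longrightarrow> tiling_orbit \<Gamma> x \<subseteq> tilings m \<P>"
  using act_tiling by (auto simp: tiling_orbit_def)

lemma tiling_in_orbit:
  assumes x: "x \<in> tilings m \<P>"
  shows "x \<in> tiling_orbit \<Gamma> x"
proof -
  obtain e where "e \<in> \<Gamma>" "act e x = x"
    using act_identity support_subset[OF x order_refl] by metis
  then show ?thesis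
    by (force simp: tiling_orbit_def)
qed

lemma hull_tiling: "y \<in> tiling_hull m b \<Gamma> \<P> x \<Longrightarrow> y \<in> tilings m \<P>"
  using closure_of_subset_topspace by (fastforce simp: tiling_hull_def)

lemma orbit_subset_hull: "x \<in> tilings m \<P> \<Longrightarrow> tiling_orbit \<Gamma> x \<subseteq> tiling_hull m b \<Gamma> \<P> x"
  unfolding tiling_hull_def using orbit_tiling by (intro closure_of_subset) simp

lemma act_hull:
  assumes x: "x \<in> tilings m \<P>" and h: "h \<in> \<Gamma>" and y: "y \<in> tiling_hull m b \<Gamma> \<P> x"
  shows "act h y \<in> tiling_hull m b \<Gamma> \<P> x"
proof -
  have "act h ` tiling_orbit \<Gamma> x \<subseteq> tiling_orbit \<Gamma> x"
  proof clarify
    fix z assume "z \<in> tiling_orbit \<Gamma> x"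
    then obtain g where g: "g \<in> \<Gamma>" "z = act g x"
      by (auto simp: tiling_orbit_def)
    then obtain k where "k \<in> \<Gamma>" "act k x = act h z"
      using act_composition[OF h g(1)] support_subset[OF x order_refl] by metis
    then show "act h z \<in> tiling_orbit \<Gamma> x"
      by (force simp: tiling_orbit_def)
  qed
  then have "act h ` tiling_hull m b \<Gamma> \<P> x \<subseteq> tiling_hull m b \<Gamma> \<P> x"
    using continuous_map_image_closure_subset[OF continuous_act[OF h], of "tiling_orbit \<Gamma> x"]
      closure_of_mono unfolding tiling_hull_def by (meson order_trans)
  then show ?thesis using y by blast
qed

text \<open>Since hulls are closed and invariant, a hull that contains \<open>x\<close> contains the whole hull of
  \<open>x\<close>; so it is enough to return to the single point \<open>x\<close> from each \<open>y\<close>.\<close>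

lemma minimal_hullI:
  assumes x: "x \<in> tilings m \<P>"
    and recur: "\<And>y. y \<in> tiling_hull m b \<Gamma> \<P> x \<Longrightarrow> x \<in> tiling_hull m b \<Gamma> \<P> y"
  shows "minimal_hull m b \<Gamma> \<P> x"
  unfolding minimal_hull_def
proof
  fix y assume y: "y \<in> tiling_hull m b \<Gamma> \<P> x"
  have sub: "tiling_orbit \<Gamma> y \<subseteq> tiling_hull m b \<Gamma> \<P> x"
    using act_hull[OF x _ y] by (auto simp: tiling_orbit_def)
  have "tiling_orbit \<Gamma> x \<subseteq> tiling_hull m b \<Gamma> \<P> y"
    using act_hull[OF hull_tiling[OF y] _ recur[OF y]] by (auto simp: tiling_orbit_def)
  then have "tiling_hull m b \<Gamma> \<P> x \<subseteq> tiling_hull m b \<Gamma> \<P> y"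
    unfolding tiling_hull_def[of _ _ _ _ x]
    by (rule closure_of_minimal) (simp add: tiling_hull_def)
  then show "subtopology (tiling_topology m b \<Gamma> \<P>) (tiling_hull m b \<Gamma> \<P> x)
      closure_of tiling_orbit \<Gamma> y = tiling_hull m b \<Gamma> \<P> x"
    using sub unfolding closure_of_subtopology tiling_hull_def[of _ _ _ _ y]
    by (simp only: Int_absorb1 Int_absorb2)
qed

lemma minimal_hull_orbit_meets:
  assumes x: "x \<in> tilings m \<P>" and min: "minimal_hull m b \<Gamma> \<P> x"
    and z: "z \<in> tiling_hull m b \<Gamma> \<P> x"
    and U: "openin (tiling_topology m b \<Gamma> \<P>) U" "x \<in> U"
  obtains g where "g \<in> \<Gamma>" "act g z \<in> U"
proof -
  have "x \<in> subtopology (tiling_topology m b \<Gamma> \<P>) (tiling_hull m b \<Gamma> \<P> x)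
      closure_of tiling_orbit \<Gamma> z"
    using min z tiling_in_orbit[OF x] orbit_subset_hull[OF x] unfolding minimal_hull_def by blast
  then have "x \<in> tiling_topology m b \<Gamma> \<P> closure_of tiling_orbit \<Gamma> z"
    by (rule subsetD[OF closure_of_subtopology_subset])
  then obtain y where "y \<in> tiling_orbit \<Gamma> z" "y \<in> U"
    using U unfolding in_closure_of by blast
  then show thesis
    using that by (auto simp: tiling_orbit_def)
qed


section \<open>Repetitive tilings have minimal hulls\<close>

text \<open>A tiling without a patch covering the ball of radius \<open>R\<close> has distance at least about \<open>1 / R\<close>
  from every tiling, so it is isolated and cannot be a limit of the orbit.\<close>

lemma hull_big_patches:
  assumes x: "x \<in> tilings m \<P>" and big: "\<And>R. ball_patches m b R x \<noteq> {}"
    and y: "y \<in> tiling_hull m b \<Gamma> \<P> x"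
  shows "ball_patches m b R y \<noteq> {}"
proof -
  define C where "C = {z \<in> tilings m \<P>. \<forall>R. ball_patches m b R z \<noteq> {}}"
  have "closedin (tiling_topology m b \<Gamma> \<P>) C"
  proof (rule closedin_tiling_topologyI)
    fix z assume "z \<in> tilings m \<P>" "z \<notin> C"
    then obtain R where R: "ball_patches m b R z = {}"
      by (auto simp: C_def)
    obtain e where e: "0 < e" "e \<le> (1::real)" "R \<le> 1 / e"
      using reciprocal_radius[OF zero_less_one] by metis
    have "tiling_dist m b \<Gamma> z w \<ge> e" for w
      using tiling_dist_lessD[of z w e] e(2) ball_patches_antimono[OF e(3)] R
      by (metis empty_iff not_less)
    then show "\<exists>e>0. \<forall>w\<in>C. tiling_dist m b \<Gamma> z w \<ge> e"
      using e(1) by blast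
  qed (auto simp: C_def)
  moreover have "tiling_orbit \<Gamma> x \<subseteq> C"
    using ball_patches_act big act_tiling[OF _ x] by (fastforce simp: tiling_orbit_def C_def)
  ultimately show ?thesis
    using y closure_of_minimal unfolding tiling_hull_def C_def by blast
qed

text \<open>If the nonempty tiles of a patch of \<open>z\<close> have no copy in \<open>x\<close>, they still have one in every tiling
  near \<open>z\<close>, where they form a patch without a copy in \<open>x\<close>. So the tilings with this copying property form a closed
  set.\<close>

lemma hull_patch_copy:
  assumes x: "x \<in> tilings m \<P>" and y: "y \<in> tiling_hull m b \<Gamma> \<P> x" and p: "p \<in> patches m y"
  obtains g where "g \<in> \<Gamma>" "act g (solid p) \<subseteq> x"
proof -
  define C where "C = {z \<in> tilings m \<P>. \<forall>p\<in>patches m z. \<exists>g\<in>\<Gamma>. act g (solid p) \<subseteq> x}"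
  have "closedin (tiling_topology m b \<Gamma> \<P>) C"
  proof (rule closedin_tiling_topologyI)
    fix z assume z: "z \<in> tilings m \<P>" "z \<notin> C"
    then obtain p where p: "p \<in> patches m z" "\<And>g. g \<in> \<Gamma> \<Longrightarrow> \<not> act g (solid p) \<subseteq> x"
      by (auto simp: C_def)
    obtain R where R: "support p \<subseteq> mcball b R"
      using patch_bounded[OF z(1) p(1)] by blast
    obtain e where e: "0 < e" "e \<le> (1::real)" "R \<le> 1 / e"
      using reciprocal_radius[OF zero_less_one] by metis
    have "tiling_dist m b \<Gamma> z w \<ge> e" if w: "w \<in> C" for w
    proof (rule ccontr)
      assume "\<not> tiling_dist m b \<Gamma> z w \<ge> e"
      then have near: "tiling_dist m b \<Gamma> z w < e"
        by simp
      have "p \<subseteq> z"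
        using p(1) by (simp add: patches_def)
      from copy_in_near_tiling[OF z(1) this R near e(2,3)]
      obtain g where g: "g \<in> \<Gamma>" "act g (solid p) \<subseteq> w" .
      have "act g (solid p) \<in> patches m w"
        using act_patch[OF g(1) patches_solid[OF p(1)] g(2)] .
      then obtain h where h: "h \<in> \<Gamma>" "act h (solid (act g (solid p))) \<subseteq> x"
        using w by (auto simp: C_def)
      have "solid (act g (solid p)) = act g (solid p)"
        unfolding solid_act by (simp add: solid_def)
      moreover obtain k where "k \<in> \<Gamma>" "act k (solid p) = act h (act g (solid p))"
        using act_composition[OF h(1) g(1)] support_subset[OF z(1), of p] p(1)
        by (metis (no_types, lifting) patches_def mem_Collect_eq support_solid)
      ultimately show False
        using h(2) p(2) by metis
    qed
    then show "\<exists>e>0. \<forall>w\<in>C. tiling_dist m b \<Gamma> z w \<ge> e"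
      using e(1) by blast
  qed (auto simp: C_def)
  moreover have "tiling_orbit \<Gamma> x \<subseteq> C"
  proof
    fix z assume "z \<in> tiling_orbit \<Gamma> x"
    then obtain g where g: "g \<in> \<Gamma>" "z = act g x"
      by (auto simp: tiling_orbit_def)
    obtain h where h: "h \<in> \<Gamma>" "act h z = x"
      using act_inverse[OF g(1)] support_subset[OF x order_refl] g(2) by metis
    have "act h (solid p) \<subseteq> x" if "p \<in> patches m z" for p
      using that act_mono[of "solid p" z h] solid_subset[of p] h(2) by (auto simp: patches_def)
    then show "z \<in> C"
      using act_tiling[OF g(1) x] g(2) h(1) by (auto simp: C_def)
  qed
  ultimately have "y \<in> C"
    using y closure_of_minimal unfolding tiling_hull_def by blast
  then show thesis
    using p that by (auto simp: C_def)
qed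

text \<open>The copy of a patch of \<open>y\<close> covering the ball of radius \<open>R\<close> covers a ball of the same radius in
  the space tiled by \<open>x\<close>, where repetitivity puts a copy of \<open>p\<close>. Pulling it back places \<open>p\<close> in \<open>y\<close>,
  and the corresponding image of \<open>y\<close> shares \<open>p\<close> with \<open>x\<close>.\<close>

lemma repetitive_in_hull:
  assumes x: "x \<in> tilings m \<P>" and big: "\<And>R. ball_patches m b R x \<noteq> {}"
    and rep: "repetitive m \<Gamma> x" and y: "y \<in> tiling_hull m b \<Gamma> \<P> x"
  shows "x \<in> tiling_hull m b \<Gamma> \<P> y"
  unfolding tiling_hull_def in_closure_of topspace_tiling_topology
proof (intro conjI x allI impI)
  fix U assume U: "x \<in> U \<and> openin (tiling_topology m b \<Gamma> \<P>) U"
  then obtain e where e: "e > 0"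
    and eU: "\<And>w. w \<in> tilings m \<P> \<Longrightarrow> tiling_dist m b \<Gamma> x w < e \<Longrightarrow> w \<in> U"
    unfolding openin_tiling_topology by metis
  obtain r where r: "0 < r" "r < e"
    using dense[OF e] by blast
  obtain p\<^sub>0 where p\<^sub>0: "p\<^sub>0 \<in> ball_patches m b (1 / r) x"
    using big by blast
  define p where "p = solid p\<^sub>0"
  have p: "p \<in> ball_patches m b (1 / r) x" "p \<in> patches m x" "p \<subseteq> x" "solid p = p"
  proof -
    show "p \<in> patches m x"
      using p\<^sub>0 by (simp add: p_def ball_patches_def patches_solid)
    then show "p \<in> ball_patches m b (1 / r) x" "p \<subseteq> x"
      using p\<^sub>0 by (simp_all add: p_def ball_patches_def) (simp add: patches_def)
    show "solid p = p"
      by (auto simp: p_def solid_def)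
  qed
  note ps = support_subset[OF x p(3)]
  obtain R where R: "R > 0" "\<And>c. c \<in> mspace m \<Longrightarrow>
      \<exists>g\<in>\<Gamma>. act g p \<subseteq> x \<and> support (act g p) \<subseteq> mcball c R"
    using rep p(2) unfolding repetitive_def mcball_of_def by metis
  obtain q where q: "q \<in> ball_patches m b R y"
    using hull_big_patches[OF x big y] by blast
  have qy: "q \<in> patches m y" "q \<subseteq> y" "mcball b R \<subseteq> support q"
    using q by (auto simp: ball_patches_def patches_def mcball_of_def)
  obtain h where h: "h \<in> \<Gamma>" "act h (solid q) \<subseteq> x"
    using hull_patch_copy[OF x y qy(1)] by blast
  obtain g where g: "g \<in> \<Gamma>" "act g p \<subseteq> x" "support (act g p) \<subseteq> mcball (h b) R"
    using R(2)[OF in_space[OF h(1) base]] by blast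
  have "mcball (h b) R \<subseteq> h ` mcball b R"
  proof
    fix u assume u: "u \<in> mcball (h b) R"
    then obtain v where "v \<in> mspace m" "u = h v"
      using image_space[OF h(1)] by (auto simp del: image_eqI)
    then show "u \<in> h ` mcball b R"
      using u base dist_invariant[OF h(1)] by auto
  qed
  then have "support (act g p) \<subseteq> support (act h (solid q))"
    using g(3) qy(3) unfolding support_act support_solid by blast
  then have "solid (act g p) \<subseteq> act h (solid q)"
    by (rule patch_in_cover[OF x h(2) g(2)])
  then have sub: "act g p \<subseteq> act h (solid q)"
    by (simp add: solid_act p(4))
  \<comment> \<open>pull the copy of \<open>p\<close> back into \<open>y\<close>, then bring it to the original position of \<open>p\<close>\<close>
  obtain h' where h': "h' \<in> \<Gamma>" "act h' (act h (solid q)) = solid q"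
    using act_inverse[OF h(1)] support_subset[OF hull_tiling[OF y] qy(2)] by (metis support_solid)
  obtain k where k: "k \<in> \<Gamma>" "act k p = act h' (act g p)"
    using act_composition[OF h'(1) g(1)] ps by metis
  obtain k' where k': "k' \<in> \<Gamma>" "act k' (act k p) = p"
    using act_inverse[OF k(1)] ps by metis
  have "act k p \<subseteq> y"
    using act_mono[OF sub, of h'] h'(2) k(2) solid_subset[of q] qy(2) by auto
  then have "p \<subseteq> act k' y"
    using act_mono[of "act k p" y k'] k'(2) by simp
  then have pk: "p \<in> ball_patches m b (1 / r) (act k' y)"
    using p(1) by (auto simp: ball_patches_def patches_def)
  obtain i where i: "i \<in> \<Gamma>" "\<And>u. u \<in> mspace m \<Longrightarrow> i u = u" "act i p = p"
    using act_identity ps by metis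
  have "tiling_dist m b \<Gamma> x (act k' y) \<le> r"
    by (rule tiling_dist_leI[OF r(1) p(1) i(1)]) (use i pk r in auto)
  then have "act k' y \<in> U"
    using eU act_tiling[OF k'(1) hull_tiling[OF y]] r(2) by force
  then show "\<exists>z. z \<in> tiling_orbit \<Gamma> y \<and> z \<in> U"
    using k'(1) by (auto simp: tiling_orbit_def)
qed

text \<open>The distance from \<open>x\<close> to itself vanishes only if each large ball is covered by a patch, by
  \<open>tiling_dist_lessD\<close>.\<close>

lemma repetitive_imp_minimal:
  assumes x: "x \<in> tilings m \<P>" and self: "tiling_dist m b \<Gamma> x x = 0"
    and rep: "repetitive m \<Gamma> x"
  shows "minimal_hull m b \<Gamma> \<P> x"
proof (rule minimal_hullI[OF x])
  fix y assume y: "y \<in> tiling_hull m b \<Gamma> \<P> x"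
  have "ball_patches m b R x \<noteq> {}" for R
  proof -
    obtain e where e: "0 < e" "e \<le> (1::real)" "R \<le> 1 / e"
      using reciprocal_radius[OF zero_less_one] by metis
    obtain p where "p \<in> ball_patches m b (1 / e) x"
      using tiling_dist_lessD[of x x e] self e by metis
    then show ?thesis
      using ball_patches_antimono[OF e(3)] by blast
  qed
  then show "x \<in> tiling_hull m b \<Gamma> \<P> y"
    using repetitive_in_hull[OF x _ rep y] by blast
qed


section \<open>Compact minimal hulls come from repetitive tilings\<close>

text \<open>A point of the space lies in a tile \<open>g ` T\<close> with \<open>T\<close> one of finitely many compact
  representatives, so its distance to \<open>g b\<close> is at most the largest distance from \<open>b\<close> to a point of
  \<open>T\<close>. The absolute values of the bounds for all prototiles are summed to obtain a common one.\<close>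

lemma orbit_of_base_relatively_dense:
  assumes fin: "finite \<P>" and x: "x \<in> tilings m \<P>"
  obtains D where "\<And>c. c \<in> mspace m \<Longrightarrow> \<exists>g\<in>\<Gamma>. mdist m c (g b) \<le> D"
proof -
  have "\<exists>D. \<forall>s\<in>X. \<forall>c\<in>fst s. \<exists>g\<in>\<Gamma>. mdist m c (g b) \<le> D" if X: "X \<in> \<P>" for X
  proof -
    obtain T a where T: "(T, a) \<in> labelled_tiles m" "X = tile_equiv m \<Gamma> `` {(T, a)}"
      using prototile_set X by (fastforce simp: prototiles_def quotient_def)
    then have "compactin mtopology T"
      by (auto simp: labelled_tiles_def tile_def mtopology_of_def)
    then obtain D where D: "T \<subseteq> mcball b D"
      using compact_bounded by blast
    have "\<exists>g\<in>\<Gamma>. mdist m c (g b) \<le> D" if s: "s \<in> X" "c \<in> fst s" for s c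
    proof -
      obtain g where g: "g \<in> \<Gamma>" "fst s = g ` T"
        using s(1) T(2) by (auto simp: tile_equiv_def)
      then obtain u where u: "u \<in> mcball b D" "c = g u"
        using s(2) D by blast
      then have "mdist m c (g b) = mdist m u b"
        using dist_invariant[OF g(1), of u b] base by simp
      then show ?thesis
        using u g(1) commute[of u b] by force
    qed
    then show ?thesis by blast
  qed
  then obtain f where f: "\<And>X s c. X \<in> \<P> \<Longrightarrow> s \<in> X \<Longrightarrow> c \<in> fst s \<Longrightarrow>
      \<exists>g\<in>\<Gamma>. mdist m c (g b) \<le> f X"
    by metis
  show thesis
  proof
    fix c assume "c \<in> mspace m"
    then have "c \<in> support x" "x \<subseteq> \<Union>\<P>"
      using x by (auto simp only: tilings_def mem_Collect_eq)
    then obtain s where "s \<in> x" "c \<in> fst s"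
      by (auto simp: support_def)
    with \<open>x \<subseteq> \<Union>\<P>\<close> obtain X where s: "s \<in> X" "X \<in> \<P>" "c \<in> fst s"
      by blast
    then obtain g where g: "g \<in> \<Gamma>" "mdist m c (g b) \<le> f X"
      using f by blast
    moreover have "f X \<le> (\<Sum>X\<in>\<P>. \<bar>f X\<bar>)"
      using member_le_sum[of X \<P> "\<lambda>X. \<bar>f X\<bar>"] fin s(2) by simp
    ultimately show "\<exists>g\<in>\<Gamma>. mdist m c (g b) \<le> (\<Sum>X\<in>\<P>. \<bar>f X\<bar>)"
      by force
  qed
qed

text \<open>The strict inequality \<open>R < n\<close> leaves room to move the copy a little, which makes this set
  open.\<close>

definition tilings_with_copy_within :: "('a set \<times> 'l) set \<Rightarrow> real \<Rightarrow> ('a set \<times> 'l) set set"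
  where "tilings_with_copy_within p n = {z \<in> tilings m \<P>.
    \<exists>g\<in>\<Gamma>. act g p \<subseteq> z \<and> (\<exists>R<n. support (act g p) \<subseteq> mcball b R)}"

lemma tilings_with_copy_within_mono:
  "n \<le> n' \<Longrightarrow> tilings_with_copy_within p n \<subseteq> tilings_with_copy_within p n'"
  unfolding tilings_with_copy_within_def by (blast intro: less_le_trans)

lemma openin_tilings_with_copy_within:
  assumes p: "solid p = p" "support p \<subseteq> mspace m"
  shows "openin (tiling_topology m b \<Gamma> \<P>) (tilings_with_copy_within p n)"
  unfolding openin_tiling_topology
proof (intro conjI ballI)
  fix z assume "z \<in> tilings_with_copy_within p n"
  then obtain g R where z: "z \<in> tilings m \<P>" and g: "g \<in> \<Gamma>" "act g p \<subseteq> z"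
    and R: "R < n" "support (act g p) \<subseteq> mcball b R"
    by (auto simp: tilings_with_copy_within_def)
  obtain e where e: "0 < e" "e \<le> 1" "e \<le> (n - R) / 2" "R \<le> 1 / e"
    using reciprocal_radius[of "(n - R) / 2" R] R(1) by auto
  have "w \<in> tilings_with_copy_within p n"
    if w: "w \<in> tilings m \<P>" "tiling_dist m b \<Gamma> z w < e" for w
  proof -
    obtain h where h: "h \<in> \<Gamma>" "act h (solid (act g p)) \<subseteq> w"
      "\<And>u. u \<in> mcball b R \<Longrightarrow> mdist m u (h u) \<le> e"
      using copy_in_near_tiling[OF z g(2) R(2) w(2) e(2,4)] by metis
    obtain k where k: "k \<in> \<Gamma>" "act k p = act h (act g p)"
      using act_composition[OF h(1) g(1)] p(2) by metis
    have "h u \<in> mcball b (R + e)" if "u \<in> mcball b R" for u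
      using that h(3)[OF that] in_space[OF h(1)] triangle[of b u "h u"] by fastforce
    then have "support (act k p) \<subseteq> mcball b (R + e)"
      using R(2) unfolding k(2) support_act[of h] by blast
    moreover have "act k p \<subseteq> w"
      using h(2) by (simp add: k(2) solid_act p(1))
    moreover have "R + e < n"
      using e(3) R(1) by (simp add: field_simps)
    ultimately show ?thesis
      using w(1) k(1) unfolding tilings_with_copy_within_def by blast
  qed
  then show "\<exists>e>0. \<forall>w\<in>tilings m \<P>. tiling_dist m b \<Gamma> z w < e \<longrightarrow> w \<in> tilings_with_copy_within p n"
    using e(1) by blast
qed (auto simp: tilings_with_copy_within_def)

text \<open>By minimality some \<open>g\<close> brings \<open>z\<close> into an open set of tilings that have a copy of \<open>p\<close> near \<open>b\<close>.
  Undoing \<open>g\<close> leaves a copy of \<open>p\<close> in \<open>z\<close>, at a distance that may depend on \<open>z\<close>.\<close>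

lemma minimal_hull_has_copies:
  assumes x: "x \<in> tilings m \<P>" and min: "minimal_hull m b \<Gamma> \<P> x"
    and p: "p \<in> patches m x" "solid p = p" and z: "z \<in> tiling_hull m b \<Gamma> \<P> x"
  obtains n :: nat where "z \<in> tilings_with_copy_within p (real n)"
proof -
  have ps: "support p \<subseteq> mspace m" "p \<subseteq> x"
    using support_subset[OF x] p(1) by (auto simp: patches_def)
  obtain R where R: "support p \<subseteq> mcball b R"
    using patch_bounded[OF x p(1)] by blast
  obtain i where i: "i \<in> \<Gamma>" "act i p = p"
    using act_identity ps(1) by metis
  have "x \<in> tilings_with_copy_within p (R + 1)"
    unfolding tilings_with_copy_within_def using x i R ps(2) by (auto intro!: bexI[of _ i] exI[of _ R])
  then obtain g where g: "g \<in> \<Gamma>" "act g z \<in> tilings_with_copy_within p (R + 1)"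
    using minimal_hull_orbit_meets[OF x min z openin_tilings_with_copy_within[OF p(2) ps(1)]] by blast
  then obtain k R' where k: "k \<in> \<Gamma>" "act k p \<subseteq> act g z" "support (act k p) \<subseteq> mcball b R'"
    by (auto simp: tilings_with_copy_within_def)
  note zt = hull_tiling[OF z]
  obtain g' where g': "g' \<in> \<Gamma>" "act g' (act g z) = z" "\<And>u. u \<in> mspace m \<Longrightarrow> g (g' u) = u"
    using act_inverse[OF g(1)] support_subset[OF zt order_refl] by metis
  obtain l where l: "l \<in> \<Gamma>" "act l p = act g' (act k p)"
    using act_composition[OF g'(1) k(1)] ps(1) by metis
  have "act l p \<subseteq> z"
    using act_mono[OF k(2), of g'] by (simp add: l(2) g'(2))
  moreover have "support (act l p) \<subseteq> mcball b (R' + mdist m b (g b))"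
  proof -
    have "g' u \<in> mcball b (R' + mdist m b (g b))" if "u \<in> mcball b R'" for u
      using isometry_pulls_ball[OF g(1), of "g' u" R'] that g'(3)[of u] in_space[OF g'(1), of u] by auto
    then show ?thesis
      using k(3) unfolding l(2) support_act[of g'] by blast
  qed
  moreover obtain n :: nat where "R' + mdist m b (g b) < real n"
    using reals_Archimedean2 by blast
  ultimately show thesis
    using that zt l(1) unfolding tilings_with_copy_within_def by blast
qed

text \<open>Compactness makes the distance in \<open>minimal_hull_has_copies\<close> uniform over the hull. For a point
  \<open>c\<close> near \<open>g b\<close>, the uniform bound at the image of \<open>x\<close> under the inverse of \<open>g\<close> yields a copy of \<open>p\<close>
  in \<open>x\<close> near \<open>g b\<close>, hence near \<open>c\<close>.\<close>

lemma minimal_compact_imp_repetitive: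
  assumes fin: "finite \<P>" and x: "x \<in> tilings m \<P>" and min: "minimal_hull m b \<Gamma> \<P> x"
    and comp: "compactin (tiling_topology m b \<Gamma> \<P>) (tiling_hull m b \<Gamma> \<P> x)"
  shows "repetitive m \<Gamma> x"
  unfolding repetitive_def
proof
  fix q assume q: "q \<in> patches m x"
  define p where "p = solid q"
  have p: "p \<in> patches m x" "solid p = p" "support p \<subseteq> mspace m"
    using patches_solid[OF q] support_subset[OF x, of p]
    by (auto simp: p_def solid_def patches_def)
  obtain D where D: "\<And>c. c \<in> mspace m \<Longrightarrow> \<exists>g\<in>\<Gamma>. mdist m c (g b) \<le> D"
    using orbit_of_base_relatively_dense[OF fin x] by metis
  let ?V = "\<lambda>n. tilings_with_copy_within p (real n)"
  have "tiling_hull m b \<Gamma> \<P> x \<subseteq> \<Union>(range ?V)"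
    using minimal_hull_has_copies[OF x min p(1,2)] by blast
  then obtain \<F> where \<F>: "finite \<F>" "\<F> \<subseteq> range ?V" "tiling_hull m b \<Gamma> \<P> x \<subseteq> \<Union>\<F>"
    using compactinD[OF comp, of "range ?V"] openin_tilings_with_copy_within[OF p(2,3)] by blast
  then obtain I where I: "finite I" "\<F> = ?V ` I"
    by (meson finite_subset_image)
  define N where "N = Max (insert 0 I)"
  have "?V n \<subseteq> ?V N" if "n \<in> I" for n
    using that I(1) by (intro tilings_with_copy_within_mono) (simp add: N_def)
  then have N: "tiling_hull m b \<Gamma> \<P> x \<subseteq> ?V N"
    using \<F>(3) I(2) by blast
  have "\<exists>g\<in>\<Gamma>. act g q \<subseteq> x \<and> support (act g q) \<subseteq> mcball c (max 1 (D + real N))"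
    if c: "c \<in> mspace m" for c
  proof -
    obtain g where g: "g \<in> \<Gamma>" "mdist m c (g b) \<le> D"
      using D[OF c] by blast
    obtain g' where g': "g' \<in> \<Gamma>" "act g (act g' x) = x"
      using act_inverse[OF g(1)] support_subset[OF x order_refl] by metis
    have "act g' x \<in> ?V N"
      using N orbit_subset_hull[OF x] g'(1) by (auto simp: tiling_orbit_def)
    then obtain k R where k: "k \<in> \<Gamma>" "act k p \<subseteq> act g' x"
      and R: "R < real N" "support (act k p) \<subseteq> mcball b R"
      by (auto simp: tilings_with_copy_within_def)
    obtain l where l: "l \<in> \<Gamma>" "act l p = act g (act k p)"
      using act_composition[OF g(1) k(1)] p(3) by metis
    have "act l p \<subseteq> x"
      using act_mono[OF k(2), of g] by (simp add: l(2) g'(2))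
    then have "act l q \<subseteq> x"
      using act_subset_iff_solid[of q x] q by (simp add: p_def patches_def)
    moreover have "g u \<in> mcball c (max 1 (D + real N))" if "u \<in> mcball b R" for u
      using that R(1) g(2) c base in_space[OF g(1)] dist_invariant[OF g(1), of b u]
        triangle[of c "g b" "g u"] by fastforce
    then have "support (act l p) \<subseteq> mcball c (max 1 (D + real N))"
      using R(2) unfolding l(2) support_act[of g] by blast
    then have "support (act l q) \<subseteq> mcball c (max 1 (D + real N))"
      by (simp add: support_act p_def)
    ultimately show ?thesis
      using l(1) by blast
  qed
  then show "\<exists>r>0. \<forall>c\<in>mspace m. \<exists>g\<in>\<Gamma>. act g q \<subseteq> x \<and> support (act g q) \<subseteq> mcball_of m c r"
    unfolding mcball_of_def by (intro exI[of _ "max 1 (D + real N)"]) auto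
qed

end

theorem proposition1p1:
  fixes m :: "complex metric" and b :: complex and \<Gamma> :: "(complex \<Rightarrow> complex) set"
    and \<P> :: "(complex set \<times> 'l::finite) set set" and x :: "(complex set \<times> 'l) set"
  assumes plane: "m = euclidean_plane \<or> m = hyperbolic_plane"
    and base: "b \<in> mspace m"
    and group: "subgroup \<Gamma> (isom_group m)"
    and protos: "finite \<P>" "\<P> \<subseteq> prototiles m \<Gamma>"
    and tiling: "x \<in> tilings m \<P>"
  shows "(tiling_dist m b \<Gamma> x x = 0 \<and> repetitive m \<Gamma> x \<longrightarrow> minimal_hull m b \<Gamma> \<P> x) \<and>
    (minimal_hull m b \<Gamma> \<P> x \<and> compactin (tiling_topology m b \<Gamma> \<P>) (tiling_hull m b \<Gamma> \<P> x)
      \<longrightarrow> repetitive m \<Gamma> x)"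
proof -
  interpret tiling_system m b \<Gamma> \<P>
    using base group protos(2) by (rule tiling_system.intro)
  show ?thesis
    using repetitive_imp_minimal[OF tiling] minimal_compact_imp_repetitive[OF protos(1) tiling]
    by blast
qed

end
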